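(* Let $d\ge 2$ be an integer, $p=d-1$, $\lambda>0$ and $u>0$, and let $\mathbf N\sim\mathrm{NDFHL}^{(d)}(\lambda,u)$ with differential entropy $h(\mathbf N)$. For $P>0$ let $$C(P)=\sup_{P_{\mathbf X}:\ \mathbb E\|\mathbf X\|^2\le P} I(\mathbf X;\mathbf X+\mathbf N),$$ the supremum being over distributions of $\mathbf X\in\mathbb R^p$ independent of $\mathbf N$. Then, as $P\to\infty$, $$C(P)=\frac p2\log P+c^*+o(1),\qquad c^*=\frac p2\log\!\left(\frac{2\pi e}{p}\right)-h(\mathbf N).$$
   Context: For an integer $d\ge2$, $p=d-1$, $\lambda>0$, $u>0$, the distribution $\mathrm{NDFHL}^{(d)}(\lambda,u)$ is the probability law on $\mathbb R^{p}$ with density $$f_{\mathbf N}(\mathbf n)=\frac{\lambda}{2^{\frac d2-1}\pi^{\frac d2}}\left(\frac{u}{\rho(\mathbf n)}\right)^{\frac d2}e^{\lambda u}K_{\frac d2}\bigl(u\rho(\mathbf n)\bigr),\qquad \rho(\mathbf n)=\sqrt{\|\mathbf n\|^2+\lambda^2},$$ where $K_\nu$ is the modified Bessel function of the second kind. Equivalently, it is the law of $\sigma\sqrt{T}\,\mathbf Z$ where $\sigma>0$, $\mathbf Z\sim\mathcal N(\mathbf 0,\mathbf I_p)$ is independent of $T$, and $T$ is inverse Gaussian with mean $\lambda/(u\sigma^2)$ and shape parameter $\lambda^2/\sigma^2$. All logarithms are natural. *)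

theory Defs
  imports "HOL-Probability.Probability"
begin

text \<open>Modified Bessel function of the second kind, via its standard integral
  representation (valid for x > 0):  K_nu(x) = int_0^infty exp(-x cosh t) cosh(nu t) dt.\<close>
definition besselK :: "real \<Rightarrow> real \<Rightarrow> real" where
  "besselK nu x = (LBINT t:{0..}. exp (- x * cosh t) * cosh (nu * t))"

definition ndfhl_density :: "real \<Rightarrow> real \<Rightarrow> real ^ 'p \<Rightarrow> real" where
  "ndfhl_density lam u n =
    (let d = real CARD('p) + 1; rho = sqrt (norm n ^ 2 + lam ^ 2) in
     lam / (2 powr (d / 2 - 1) * pi powr (d / 2)) * (u / rho) powr (d / 2)
       * exp (lam * u) * besselK (d / 2) (u * rho))"

definition ndfhl :: "real \<Rightarrow> real \<Rightarrow> (real ^ 'p) measure" where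
  "ndfhl lam u = density lborel (\<lambda>n. ennreal (ndfhl_density lam u n))"

definition ndfhl_entropy :: "real \<Rightarrow> real \<Rightarrow> 'p::finite itself \<Rightarrow> real" where
  "ndfhl_entropy lam u _ = prob_space.entropy (ndfhl lam u :: (real ^ 'p) measure) (exp 1) lborel id"

definition ndfhl_mi :: "real \<Rightarrow> real \<Rightarrow> (real ^ 'p) measure \<Rightarrow> real" where
  "ndfhl_mi lam u mu =
     prob_space.mutual_information (mu \<Otimes>\<^sub>M ndfhl lam u) (exp 1) borel borel
       fst (\<lambda>z. fst z + snd z)"

definition ndfhl_capacity :: "real \<Rightarrow> real \<Rightarrow> 'p::finite itself \<Rightarrow> real \<Rightarrow> real" where
  "ndfhl_capacity lam u _ P = Sup {ndfhl_mi lam u (mu :: (real ^ 'p) measure) | mu.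
       prob_space mu \<and> sets mu = sets borel \<and>
       integrable mu (\<lambda>x. norm x ^ 2) \<and> (\<integral>x. norm x ^ 2 \<partial>mu) \<le> P}"

end

theory Submission
  imports Defs
begin

text \<open>
  Since \<open>I(X; X + N) = h(X + N) - h(N)\<close>, only the output entropy has to be bounded. Comparing the output
  density with the Gaussian of variance \<open>P / p\<close> per coordinate (Gibbs' inequality) bounds it from above by
  \<open>p / 2 * ln (2 * pi * e * P / p) + p * V / (2 * P)\<close>, where \<open>V\<close> is the second moment of the noise. For Gaussian
  input of that variance, exchanging the roles of input and noise gives \<open>h(X + N) - h(X) = I(N; X + N) \<ge> 0\<close>,
  so the capacity exceeds the claimed expansion by at most \<open>p * V / (2 * P)\<close> and is never below it.

  That the density integrates to one and has a finite second moment follows from its representation as a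
  mixture of Gaussians: Tonelli reduces both integrals to a Bessel function of order one half, which is elementary.
\<close>

section \<open>Additive noise channels\<close>

lemma nn_integral_lborel_translate:
  fixes F :: "'a::euclidean_space \<Rightarrow> ennreal"
  assumes [measurable]: "F \<in> borel_measurable borel"
  shows "(\<integral>\<^sup>+n. F (x + n) \<partial>lborel) = (\<integral>\<^sup>+n. F n \<partial>lborel)"
  by (subst (2) lborel_distr_plus[of x, symmetric]) (simp add: nn_integral_distr)

lemma nn_integral_lborel_reflect:
  fixes F :: "'a::euclidean_space \<Rightarrow> ennreal"
  assumes [measurable]: "F \<in> borel_measurable borel"
  shows "(\<integral>\<^sup>+n. F (x - n) \<partial>lborel) = (\<integral>\<^sup>+n. F n \<partial>lborel)"
  by (subst (2) lborel_affine[of "-1" x])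
     (simp_all add: nn_integral_distr nn_integral_density)

lemma integral_lborel_reflect:
  fixes F :: "'a::euclidean_space \<Rightarrow> real"
  assumes [measurable]: "F \<in> borel_measurable borel"
  shows "(\<integral>n. F (x - n) \<partial>lborel) = (\<integral>n. F n \<partial>lborel)"
  by (subst (2) lborel_affine[of "-1" x])
     (simp_all add: integral_distr integral_density density_1)

text \<open>The inequality \<open>ln t \<le> t - 1\<close> at \<open>t = b / a\<close>, scaled by
  \<open>a\<close>. When \<open>a\<close> and \<open>b\<close> are values of two probability
  densities, the correction \<open>b - a\<close> integrates to zero and Gibbs' inequality
  remains.\<close>

lemma gibbs_pointwise:
  fixes a b :: real
  assumes "0 < a" "0 < b"
  shows "a * ln b \<le> a * ln a + (b - a)"
proof -
  have "ln (b / a) \<le> b / a - 1"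
    using assms by (intro ln_le_minus_one) simp
  then have "a * ln (b / a) \<le> a * (b / a - 1)"
    using assms by (intro mult_left_mono) auto
  moreover have "a * (b / a - 1) = b - a"
    using assms by (simp add: field_simps)
  ultimately show ?thesis
    using assms by (simp add: ln_div right_diff_distrib)
qed

text \<open>Turns a finite second moment into integrability of a log density: a Gaussian minorant
  limits the logarithm from below by a quadratic, a constant majorant limits it from above.\<close>

lemma abs_ln_quadratic:
  fixes h :: "'a::real_normed_vector \<Rightarrow> real"
  assumes "0 < c'" "0 \<le> k'" and lower: "\<And>y. c' * exp (- k' * (norm y)\<^sup>2) \<le> h y" and upper: "\<And>y. h y \<le> B"
  shows "\<bar>ln (h y)\<bar> \<le> (\<bar>ln B\<bar> + \<bar>ln c'\<bar>) + k' * (norm y)\<^sup>2"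
proof -
  have pos: "0 < c' * exp (- k' * (norm y)\<^sup>2)" using assms by simp
  then have "0 < h y" using lower[of y] by linarith
  then have "ln (h y) \<le> ln B" using upper[of y] by simp
  moreover have "ln (c' * exp (- k' * (norm y)\<^sup>2)) \<le> ln (h y)"
    using lower[of y] pos by (simp only: ln_le_cancel_iff \<open>0 < h y\<close>)
  then have "ln c' - k' * (norm y)\<^sup>2 \<le> ln (h y)"
    using assms(1) by (simp add: ln_mult)
  moreover have "0 \<le> k' * (norm y)\<^sup>2" using assms by simp
  ultimately show ?thesis by linarith
qed

text \<open>Collects what the entropy argument asks of the noise, so that it applies both to the
  given noise and to a Gaussian once input and noise trade places. The two-sided bound controls
  \<open>ln (f x)\<close>, and evenness stands in for a vanishing mean.\<close>

locale noise_density =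
  fixes f :: "'a::euclidean_space \<Rightarrow> real" and c k B V :: real
  assumes measurable_f [measurable]: "f \<in> borel_measurable borel"
    and c_pos: "0 < c" and k_nonneg: "0 \<le> k" and V_nonneg: "0 \<le> V"
    and f_lower: "c * exp (- k * (norm x)\<^sup>2) \<le> f x"
    and f_upper: "f x \<le> B"
    and f_even: "f (- x) = f x"
    and f_total: "(\<integral>\<^sup>+x. ennreal (f x) \<partial>lborel) = 1"
    and f_moment: "(\<integral>\<^sup>+x. ennreal (f x * (norm x)\<^sup>2) \<partial>lborel) = ennreal V"
begin

lemma f_pos: "0 < f x"
  using f_lower[of x] c_pos by (meson exp_gt_zero less_le_trans mult_pos_pos)

lemma f_nonneg [simp]: "0 \<le> f x"
  using f_pos[of x] by simp

abbreviation noise :: "'a measure" where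
  "noise \<equiv> density lborel (\<lambda>x. ennreal (f x))"

lemma prob_space_noise: "prob_space noise"
  by (rule prob_spaceI) (simp add: emeasure_density f_total)

lemma noise_power:
  "integrable noise (\<lambda>x. (norm x)\<^sup>2)" "(\<integral>x. (norm x)\<^sup>2 \<partial>noise) = V"
proof -
  have "has_bochner_integral lborel (\<lambda>x. f x * (norm x)\<^sup>2) V"
    using f_moment V_nonneg by (intro has_bochner_integral_nn_integral) auto
  then show "integrable noise (\<lambda>x. (norm x)\<^sup>2)" "(\<integral>x. (norm x)\<^sup>2 \<partial>noise) = V"
    by (auto simp: integrable_density integral_density has_bochner_integral_iff)
qed

text \<open>Log densities of centred Gaussians have this quadratic form, so for Gaussian
  \<open>f\<close> this evaluates the entropy.\<close>

lemma integral_quadratic: "(\<integral>x. f x * (a - b * (norm x)\<^sup>2) \<partial>lborel) = a - b * V"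
proof -
  interpret prob_space noise by (rule prob_space_noise)
  have "(\<integral>x. f x * (a - b * (norm x)\<^sup>2) \<partial>lborel) = (\<integral>x. a - b * (norm x)\<^sup>2 \<partial>noise)"
    by (subst integral_density) auto
  also have "\<dots> = a - b * V"
    using noise_power prob_space by (simp)
  finally show ?thesis .
qed

text \<open>Evenness allows \<open>x + n\<close> to be replaced by \<open>x - n\<close>. Adding both
  versions, the parallelogram identity removes the cross term, so everything stays a nonnegative
  integral and no first moment has to be discussed.\<close>

lemma moment_translate:
  "(\<integral>\<^sup>+n. ennreal (f n * (norm (x + n))\<^sup>2) \<partial>lborel) = ennreal ((norm x)\<^sup>2 + V)" (is "?J = _")
proof -
  have reflect: "?J = (\<integral>\<^sup>+n. ennreal (f n * (norm (x - n))\<^sup>2) \<partial>lborel)"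
    by (subst nn_integral_lborel_reflect[of _ 0, symmetric]) (simp_all add: f_even)
  have "2 * ?J = ?J + (\<integral>\<^sup>+n. ennreal (f n * (norm (x - n))\<^sup>2) \<partial>lborel)"
    by (simp add: reflect[symmetric] mult_2)
  also have "\<dots> = (\<integral>\<^sup>+n. ennreal (f n * (norm (x + n))\<^sup>2) + ennreal (f n * (norm (x - n))\<^sup>2) \<partial>lborel)"
    by (simp add: nn_integral_add)
  also have "\<dots> = (\<integral>\<^sup>+n. ennreal (2 * (norm x)\<^sup>2) * ennreal (f n) + 2 * ennreal (f n * (norm n)\<^sup>2) \<partial>lborel)"
  proof (intro nn_integral_cong)
    fix n
    have *: "(norm (x + n))\<^sup>2 + (norm (x - n))\<^sup>2 = 2 * (norm x)\<^sup>2 + 2 * (norm n)\<^sup>2"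
      by (simp add: power2_norm_eq_inner inner_simps inner_commute)
    have "ennreal (f n * (norm (x + n))\<^sup>2) + ennreal (f n * (norm (x - n))\<^sup>2)
       = ennreal (f n * ((norm (x + n))\<^sup>2 + (norm (x - n))\<^sup>2))"
      by (simp add: distrib_left)
    also have "\<dots> = ennreal (2 * (norm x)\<^sup>2 * f n + 2 * (f n * (norm n)\<^sup>2))"
      unfolding * by (simp add: algebra_simps)
    also have "\<dots> = ennreal (2 * (norm x)\<^sup>2) * ennreal (f n) + 2 * ennreal (f n * (norm n)\<^sup>2)"
      by (simp add: ennreal_mult'')
    finally show "ennreal (f n * (norm (x + n))\<^sup>2) + ennreal (f n * (norm (x - n))\<^sup>2)
       = ennreal (2 * (norm x)\<^sup>2) * ennreal (f n) + 2 * ennreal (f n * (norm n)\<^sup>2)" .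
  qed
  also have "\<dots> = ennreal (2 * (norm x)\<^sup>2) + 2 * ennreal V"
    by (simp add: nn_integral_add nn_integral_cmult f_total f_moment)
  also have "\<dots> = 2 * ennreal ((norm x)\<^sup>2 + V)"
    using V_nonneg by (simp add: ennreal_mult'' distrib_left)
  finally show ?thesis
    by (simp add: ennreal_mult_cancel_left)
qed

end

locale noise_channel = noise_density f c k B V + mu: prob_space mu
  for f :: "'a::euclidean_space \<Rightarrow> real" and c k B V and mu :: "'a measure" +
  assumes sets_mu [measurable_cong]: "sets mu = sets borel"
    and power_mu: "integrable mu (\<lambda>x. (norm x)\<^sup>2)"
begin

text \<open>The convolution of the input law with the noise density. The Bochner integral is
  meaningful because \<open>f\<close> is bounded and \<open>mu\<close> is a probability
  measure.\<close>

definition out :: "'a \<Rightarrow> real" where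
  "out y = (\<integral>x. f (y - x) \<partial>mu)"

abbreviation joint :: "('a \<times> 'a) measure" where
  "joint \<equiv> mu \<Otimes>\<^sub>M noise"

section \<open>The output density and the joint law of input and output\<close>

lemma space_mu [simp]: "space mu = UNIV"
  using sets_eq_imp_space_eq[OF sets_mu] by simp

lemma information_space_joint: "information_space joint (exp 1)"
proof -
  interpret noise: prob_space noise by (rule prob_space_noise)
  interpret pair_prob_space mu noise ..
  show ?thesis by unfold_locales simp
qed

lemma integrable_shift: "integrable mu (\<lambda>x. f (y - x))"
  by (rule mu.integrable_const_bound[where B=B]) (use f_upper in auto)

lemma measurable_out [measurable]: "out \<in> borel_measurable borel"
  unfolding out_def by measurable

lemma out_le: "out y \<le> B"
  unfolding out_def
  using integral_mono[OF integrable_shift[of y] mu.integrable_const[of B]] f_upper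
  by (simp add: mu.prob_space flip: space_mu)

text \<open>A Gaussian minorant survives averaging over the input:
  \<open>|y - x|^2 \<le> 2 |y|^2 + 2 |x|^2\<close> separates the variables at the price of doubling
  the exponent. The constant is \<open>c\<close> times the integral \<open>I\<close> of a strictly
  positive function, hence positive.\<close>

lemma out_ge: "\<exists>c'>0. \<forall>y. c' * exp (- (2 * k) * (norm y)\<^sup>2) \<le> out y"
proof -
  define I where "I = (\<integral>x. exp (- (2 * k) * (norm x)\<^sup>2) \<partial>mu)"
  have int: "integrable mu (\<lambda>x. exp (- (2 * k) * (norm x)\<^sup>2))"
    using k_nonneg by (intro mu.integrable_const_bound[where B=1]) auto
  have "I \<noteq> 0"
  proof
    assume "I = 0"
    then have "AE x in mu. exp (- (2 * k) * (norm x)\<^sup>2) = 0"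
      unfolding I_def using int by (subst (asm) integral_nonneg_eq_0_iff_AE) auto
    then show False by simp
  qed
  moreover have "0 \<le> I" unfolding I_def by simp
  ultimately have "0 < I" by simp
  have "c * I * exp (- (2 * k) * (norm y)\<^sup>2) \<le> out y" for y
  proof -
    have "c * I * exp (- (2 * k) * (norm y)\<^sup>2)
        = (\<integral>x. c * exp (- (2 * k) * (norm y)\<^sup>2) * exp (- (2 * k) * (norm x)\<^sup>2) \<partial>mu)"
      by (simp add: I_def)
    also have "\<dots> \<le> out y"
      unfolding out_def
    proof (intro integral_mono integrable_shift integrable_mult_right int)
      fix x
      have "0 \<le> (norm (y + x))\<^sup>2" by simp
      then have "(norm (y - x))\<^sup>2 \<le> 2 * (norm y)\<^sup>2 + 2 * (norm x)\<^sup>2"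
        by (simp add: power2_norm_eq_inner inner_simps inner_commute)
      then have "k * (norm (y - x))\<^sup>2 \<le> k * (2 * (norm y)\<^sup>2 + 2 * (norm x)\<^sup>2)"
        using k_nonneg by (rule mult_left_mono)
      then have "exp (- (2 * k) * (norm y)\<^sup>2) * exp (- (2 * k) * (norm x)\<^sup>2) \<le> exp (- k * (norm (y - x))\<^sup>2)"
        by (simp add: exp_add[symmetric] algebra_simps)
      then have "c * (exp (- (2 * k) * (norm y)\<^sup>2) * exp (- (2 * k) * (norm x)\<^sup>2)) \<le> c * exp (- k * (norm (y - x))\<^sup>2)"
        using c_pos by simp
      also have "\<dots> \<le> f (y - x)" by (rule f_lower)
      finally show "c * exp (- (2 * k) * (norm y)\<^sup>2) * exp (- (2 * k) * (norm x)\<^sup>2) \<le> f (y - x)"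
        by (simp add: mult.assoc)
    qed
    finally show ?thesis .
  qed
  then show ?thesis
    using \<open>0 < I\<close> c_pos by (intro exI[of _ "c * I"]) auto
qed

lemma out_pos: "0 < out y"
proof -
  obtain c' where "c' > 0" and *: "\<And>y. c' * exp (- (2 * k) * (norm y)\<^sup>2) \<le> out y"
    using out_ge by auto
  then have "0 < c' * exp (- (2 * k) * (norm y)\<^sup>2)" by simp
  also have "\<dots> \<le> out y" by (rule *)
  finally show ?thesis .
qed

text \<open>Given the input \<open>x\<close>, the output is noise shifted by \<open>x\<close>.
  Taking \<open>mu\<close> itself as reference measure of the first coordinate covers inputs without
  Lebesgue density, such as discrete ones.\<close>

lemma distributed_joint:
  "distributed joint (mu \<Otimes>\<^sub>M lborel) (\<lambda>z. (fst z, fst z + snd z)) (\<lambda>z. ennreal (f (snd z - fst z)))"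
  unfolding distributed_def
proof (intro conjI)
  interpret noise: prob_space noise by (rule prob_space_noise)
  show "(\<lambda>z. (fst z, fst z + snd z)) \<in> joint \<rightarrow>\<^sub>M mu \<Otimes>\<^sub>M lborel"
    by measurable
  show "(\<lambda>z. ennreal (f (snd z - fst z))) \<in> borel_measurable (mu \<Otimes>\<^sub>M lborel)"
    by measurable
  show "distr joint (mu \<Otimes>\<^sub>M lborel) (\<lambda>z. (fst z, fst z + snd z))
      = density (mu \<Otimes>\<^sub>M lborel) (\<lambda>z. ennreal (f (snd z - fst z)))" (is "?L = ?R")
  proof (rule measure_eqI)
    fix A assume "A \<in> sets ?L"
    then have A [measurable]: "A \<in> sets (mu \<Otimes>\<^sub>M lborel)" by simp
    have "emeasure ?L A = (\<integral>\<^sup>+z. indicator A z \<partial>?L)"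
      using A by (subst nn_integral_indicator) auto
    also have "\<dots> = (\<integral>\<^sup>+z. indicator A (fst z, fst z + snd z) \<partial>joint)"
      by (subst nn_integral_distr) auto
    also have "\<dots> = (\<integral>\<^sup>+x. \<integral>\<^sup>+n. indicator A (x, x + n) \<partial>noise \<partial>mu)"
      by (subst noise.nn_integral_fst[symmetric]) auto
    \<comment> \<open>Writing \<open>f n\<close> as \<open>f (x + n - x)\<close> makes the integrand
      a function of \<open>x + n\<close>, ready for translation invariance.\<close>
    also have "\<dots> = (\<integral>\<^sup>+x. \<integral>\<^sup>+n. ennreal (f (x + n - x)) * indicator A (x, x + n) \<partial>lborel \<partial>mu)"
      by (intro nn_integral_cong) (subst nn_integral_density, auto)
    also have "\<dots> = (\<integral>\<^sup>+x. \<integral>\<^sup>+y. ennreal (f (y - x)) * indicator A (x, y) \<partial>lborel \<partial>mu)"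
      by (rule nn_integral_cong, rule nn_integral_lborel_translate) measurable
    also have "\<dots> = (\<integral>\<^sup>+z. ennreal (f (snd z - fst z)) * indicator A z \<partial>(mu \<Otimes>\<^sub>M lborel))"
      by (subst lborel.nn_integral_fst[symmetric]) auto
    also have "\<dots> = emeasure ?R A"
      by (rule emeasure_density[symmetric]) measurable
    finally show "emeasure ?L A = emeasure ?R A" .
  qed simp
qed

lemma distributed_out: "distributed joint lborel (\<lambda>z. fst z + snd z) (\<lambda>y. ennreal (out y))"
proof -
  interpret joint: information_space joint "exp 1" by (rule information_space_joint)
  have "distributed joint lborel (\<lambda>z. fst z + snd z) (\<lambda>y. \<integral>\<^sup>+x. ennreal (f (snd (x, y) - fst (x, y))) \<partial>mu)"
    by (rule joint.distr_marginal2[OF _ _ distributed_joint]) (unfold_locales)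
  moreover have "(\<integral>\<^sup>+x. ennreal (f (snd (x, y) - fst (x, y))) \<partial>mu) = ennreal (out y)" for y
    unfolding out_def using integrable_shift by (simp add: nn_integral_eq_integral)
  ultimately show ?thesis by simp
qed

lemma distributed_fst: "distributed joint mu fst (\<lambda>x. ennreal 1)"
proof -
  interpret noise: prob_space noise by (rule prob_space_noise)
  show ?thesis
    by (auto simp: distributed_def noise.distr_pair_fst density_1)
qed

lemma distributed_snd: "distributed joint lborel snd (\<lambda>x. ennreal (f x))"
proof -
  interpret noise: prob_space noise by (rule prob_space_noise)
  have "distr joint lborel snd = noise"
  proof (rule measure_eqI)
    fix A assume "A \<in> sets (distr joint lborel snd)"
    then have A [measurable]: "A \<in> sets borel" by simp
    have "emeasure (distr joint lborel snd) A = emeasure joint (space mu \<times> A)"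
      by (subst emeasure_distr) (auto simp: space_pair_measure intro!: arg_cong2[where f=emeasure])
    also have "\<dots> = emeasure noise A"
      by (subst noise.emeasure_pair_measure_Times) (auto simp: mu.emeasure_space_1 simp del: space_mu)
    finally show "emeasure (distr joint lborel snd) A = emeasure noise A" .
  qed simp
  then show ?thesis by (simp add: distributed_def)
qed

lemma output_power:
  "integrable joint (\<lambda>z. (norm (fst z + snd z))\<^sup>2)"
  "(\<integral>z. (norm (fst z + snd z))\<^sup>2 \<partial>joint) = (\<integral>x. (norm x)\<^sup>2 \<partial>mu) + V"
proof -
  interpret noise: prob_space noise by (rule prob_space_noise)
  have "(\<integral>\<^sup>+z. ennreal ((norm (fst z + snd z))\<^sup>2) \<partial>joint)
      = (\<integral>\<^sup>+x. \<integral>\<^sup>+n. ennreal ((norm (x + n))\<^sup>2) \<partial>noise \<partial>mu)"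
    by (subst noise.nn_integral_fst[symmetric]) auto
  also have "\<dots> = (\<integral>\<^sup>+x. \<integral>\<^sup>+n. ennreal (f n * (norm (x + n))\<^sup>2) \<partial>lborel \<partial>mu)"
    by (intro nn_integral_cong) (subst nn_integral_density, auto simp: ennreal_mult'')
  also have "\<dots> = (\<integral>\<^sup>+x. ennreal ((norm x)\<^sup>2 + V) \<partial>mu)"
    by (simp add: moment_translate)
  also have "\<dots> = ennreal ((\<integral>x. (norm x)\<^sup>2 \<partial>mu) + V)"
    using power_mu V_nonneg by (subst nn_integral_eq_integral) (auto simp: mu.prob_space simp del: space_mu)
  finally have "(\<integral>\<^sup>+z. ennreal ((norm (fst z + snd z))\<^sup>2) \<partial>joint) = ennreal ((\<integral>x. (norm x)\<^sup>2 \<partial>mu) + V)" .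
  then have "has_bochner_integral joint (\<lambda>z. (norm (fst z + snd z))\<^sup>2) ((\<integral>x. (norm x)\<^sup>2 \<partial>mu) + V)"
    using V_nonneg by (intro has_bochner_integral_nn_integral) (auto intro!: add_nonneg_nonneg)
  then show "integrable joint (\<lambda>z. (norm (fst z + snd z))\<^sup>2)"
    "(\<integral>z. (norm (fst z + snd z))\<^sup>2 \<partial>joint) = (\<integral>x. (norm x)\<^sup>2 \<partial>mu) + V"
    by (auto simp: has_bochner_integral_iff)
qed

lemma integrable_quadratic_output:
  assumes [measurable]: "h \<in> borel_measurable borel" and "\<And>y. \<bar>h y\<bar> \<le> a + b * (norm y)\<^sup>2"
  shows "integrable joint (\<lambda>z. h (fst z + snd z))"
proof -
  interpret joint: information_space joint "exp 1" by (rule information_space_joint)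
  show ?thesis
  proof (rule Bochner_Integration.integrable_bound)
    show "integrable joint (\<lambda>z. a + b * (norm (fst z + snd z))\<^sup>2)"
      using output_power(1) by (intro Bochner_Integration.integrable_add integrable_mult_right) auto
    show "AE z in joint. norm (h (fst z + snd z)) \<le> norm (a + b * (norm (fst z + snd z))\<^sup>2)"
      using order_trans[OF assms(2) abs_ge_self] by simp
  qed measurable
qed

lemma integrable_ln_out: "integrable joint (\<lambda>z. ln (out (fst z + snd z)))"
proof -
  obtain c' where "c' > 0" and *: "\<And>y. c' * exp (- (2 * k) * (norm y)\<^sup>2) \<le> out y"
    using out_ge by auto
  show ?thesis
    by (rule integrable_quadratic_output[OF _ abs_ln_quadratic[OF \<open>c' > 0\<close> _ * out_le]])
       (use k_nonneg in auto)
qed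

text \<open>The bound \<open>f x * |ln (f x)| \<le> f x * (const + k |x|^2)\<close> is integrable by
  total mass and second moment of the noise.\<close>

lemma integrable_ln_noise: "integrable joint (\<lambda>z. ln (f (snd z)))"
proof -
  have *: "integrable lborel (\<lambda>x. f x * (\<bar>ln B\<bar> + \<bar>ln c\<bar>))"
  proof -
    have "has_bochner_integral lborel f 1"
      using f_total by (intro has_bochner_integral_nn_integral) auto
    then show ?thesis by (auto simp: has_bochner_integral_iff)
  qed
  have "has_bochner_integral lborel (\<lambda>x. f x * (norm x)\<^sup>2) V"
    using f_moment V_nonneg by (intro has_bochner_integral_nn_integral) auto
  then have "integrable lborel (\<lambda>x. k * (f x * (norm x)\<^sup>2))"
    by (auto simp: has_bochner_integral_iff)
  from Bochner_Integration.integrable_add[OF * this]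
  have "integrable lborel (\<lambda>x. f x * ln (f x))"
  proof (rule Bochner_Integration.integrable_bound)
    have "\<bar>f x * ln (f x)\<bar> \<le> f x * ((\<bar>ln B\<bar> + \<bar>ln c\<bar>) + k * (norm x)\<^sup>2)" for x
      unfolding abs_mult
      using abs_ln_quadratic[OF c_pos k_nonneg f_lower f_upper, of x] by (simp add: mult_left_mono)
    also have "f x * ((\<bar>ln B\<bar> + \<bar>ln c\<bar>) + k * (norm x)\<^sup>2)
        \<le> \<bar>f x * (\<bar>ln B\<bar> + \<bar>ln c\<bar>) + k * (f x * (norm x)\<^sup>2)\<bar>" for x
      by (simp add: algebra_simps)
    finally show "AE x in lborel. norm (f x * ln (f x)) \<le> norm (f x * (\<bar>ln B\<bar> + \<bar>ln c\<bar>) + k * (f x * (norm x)\<^sup>2))"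
      by simp
  qed measurable
  then show ?thesis
    by (subst (asm) distributed_integrable[OF distributed_snd]) auto
qed

text \<open>Relative to \<open>mu\<close> and Lebesgue measure the information density is
  \<open>ln (f (y - x)) - ln (out y)\<close>. Both terms are integrable separately, and
  \<open>y - x\<close> is the noise, so their means are negated entropies of noise and output. The
  second claim thus says that adding an independent input of finite power cannot lower the
  entropy.\<close>

lemma information_decomposition:
  "prob_space.mutual_information joint (exp 1) borel borel fst (\<lambda>z. fst z + snd z)
     = (\<integral>x. f x * ln (f x) \<partial>lborel) - (\<integral>y. out y * ln (out y) \<partial>lborel)"
  "0 \<le> (\<integral>x. f x * ln (f x) \<partial>lborel) - (\<integral>y. out y * ln (out y) \<partial>lborel)"
proof -
  interpret joint: information_space joint "exp 1" by (rule information_space_joint)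
  have ln [simp]: "log (exp 1) x = ln x" for x :: real
    by (simp add: log_def)
  let ?F = "\<lambda>z. f (snd z - fst z)"
  have sf: "sigma_finite_measure mu" "sigma_finite_measure (lborel :: 'a measure)"
    by unfold_locales
  have noise_int: "integrable (mu \<Otimes>\<^sub>M lborel) (\<lambda>z. ?F z * ln (?F z))"
    using integrable_ln_noise by (subst distributed_integrable[OF distributed_joint]) auto
  have out_int: "integrable (mu \<Otimes>\<^sub>M lborel) (\<lambda>z. ?F z * ln (out (snd z)))"
    using integrable_ln_out by (subst distributed_integrable[OF distributed_joint]) auto
  \<comment> \<open>Mutual information sees only the sigma-algebras of its target measures, so
    \<open>borel\<close> may be exchanged for the reference measures \<open>mu\<close> and
    \<open>lborel\<close>.\<close>
  have MI: "joint.mutual_information (exp 1) borel borel fst (\<lambda>z. fst z + snd z)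
      = joint.mutual_information (exp 1) mu lborel fst (\<lambda>z. fst z + snd z)"
    unfolding joint.mutual_information_def
    by (intro arg_cong2[where f="KL_divergence (exp 1)"] arg_cong2[where f=pair_measure] distr_cong sets_pair_measure_cong)
       (auto simp: sets_mu)
  have split: "?F z * log (exp 1) (?F z / (1 * out (snd z))) = ?F z * ln (?F z) - ?F z * ln (out (snd z))" for z
    using out_pos[of "snd z"] f_pos[of "snd z - fst z"] by (simp add: ln_div right_diff_distrib)
  have "joint.mutual_information (exp 1) mu lborel fst (\<lambda>z. fst z + snd z)
      = (\<integral>z. ?F z * log (exp 1) (?F z / (1 * out (snd z))) \<partial>(mu \<Otimes>\<^sub>M lborel))"
    using out_pos
    by (intro joint.mutual_information_distr[OF sf distributed_fst _ distributed_out _ distributed_joint])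
       (auto intro: less_imp_le)
  also have "\<dots> = (\<integral>z. ?F z * ln (?F z) \<partial>(mu \<Otimes>\<^sub>M lborel)) - (\<integral>z. ?F z * ln (out (snd z)) \<partial>(mu \<Otimes>\<^sub>M lborel))"
    unfolding split by (rule Bochner_Integration.integral_diff[OF noise_int out_int])
  also have "(\<integral>z. ?F z * ln (?F z) \<partial>(mu \<Otimes>\<^sub>M lborel)) = (\<integral>z. ln (f (snd z)) \<partial>joint)"
    by (subst distributed_integral[OF distributed_joint]) auto
  also have "\<dots> = (\<integral>x. f x * ln (f x) \<partial>lborel)"
    by (subst distributed_integral[OF distributed_snd]) auto
  also have "(\<integral>z. ?F z * ln (out (snd z)) \<partial>(mu \<Otimes>\<^sub>M lborel)) = (\<integral>z. ln (out (fst z + snd z)) \<partial>joint)"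
    by (subst distributed_integral[OF distributed_joint]) auto
  also have "\<dots> = (\<integral>y. out y * ln (out y) \<partial>lborel)"
    using out_pos by (subst distributed_integral[OF distributed_out]) (auto intro: less_imp_le)
  finally have decomp: "joint.mutual_information (exp 1) mu lborel fst (\<lambda>z. fst z + snd z)
     = (\<integral>x. f x * ln (f x) \<partial>lborel) - (\<integral>y. out y * ln (out y) \<partial>lborel)" .
  then show "joint.mutual_information (exp 1) borel borel fst (\<lambda>z. fst z + snd z)
     = (\<integral>x. f x * ln (f x) \<partial>lborel) - (\<integral>y. out y * ln (out y) \<partial>lborel)"
    unfolding MI .
  have "0 \<le> joint.mutual_information (exp 1) mu lborel fst (\<lambda>z. fst z + snd z)"
  proof (rule joint.mutual_information_nonneg[OF sf distributed_fst _ distributed_out _ distributed_joint])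
    show "integrable (mu \<Otimes>\<^sub>M lborel) (\<lambda>z. ?F z * log (exp 1) (?F z / (1 * out (snd z))))"
      unfolding split by (rule Bochner_Integration.integrable_diff[OF noise_int out_int])
  qed (use out_pos in \<open>auto intro: less_imp_le\<close>)
  then show "0 \<le> (\<integral>x. f x * ln (f x) \<partial>lborel) - (\<integral>y. out y * ln (out y) \<partial>lborel)"
    unfolding decomp .
qed

text \<open>Gibbs' inequality against a comparison density \<open>\<phi>\<close>. As
  \<open>ln (\<phi> y)\<close> is quadratic in the norm, the cross entropy depends on the output law
  only through its second moment, which \<open>output_power\<close> supplies.\<close>

lemma output_entropy_le:
  fixes \<phi> :: "'a \<Rightarrow> real"
  assumes [measurable]: "\<phi> \<in> borel_measurable borel"
    and pos: "\<And>y. 0 < \<phi> y" and total: "(\<integral>\<^sup>+y. ennreal (\<phi> y) \<partial>lborel) = 1"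
    and ln_eq: "\<And>y. ln (\<phi> y) = a - b * (norm y)\<^sup>2"
  shows "- (\<integral>y. out y * ln (out y) \<partial>lborel) \<le> - a + b * ((\<integral>x. (norm x)\<^sup>2 \<partial>mu) + V)"
proof -
  interpret joint: information_space joint "exp 1" by (rule information_space_joint)
  note nonneg = less_imp_le[OF out_pos]
  have "has_bochner_integral lborel \<phi> 1"
    using total pos by (intro has_bochner_integral_nn_integral) (auto intro: less_imp_le)
  then have phi: "integrable lborel \<phi>" "(\<integral>y. \<phi> y \<partial>lborel) = 1"
    by (auto simp: has_bochner_integral_iff)
  \<comment> \<open>The factor 1 is the constant test function in the product shape that
    \<open>distributed_integrable\<close> expects.\<close>
  have int_out: "integrable lborel (\<lambda>y. out y * 1)"
    by (subst distributed_integrable[OF distributed_out]) (auto simp: nonneg)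
  have total_out: "(\<integral>y. out y * 1 \<partial>lborel) = 1"
    by (subst distributed_integral[OF distributed_out]) (auto simp: nonneg joint.prob_space)
  have int_ln: "integrable lborel (\<lambda>y. out y * ln (out y))"
    using integrable_ln_out by (subst distributed_integrable[OF distributed_out]) (auto simp: nonneg)
  have ln_phi: "ln (\<phi> (fst z + snd z)) = a - b * (norm (fst z + snd z))\<^sup>2" for z :: "'a \<times> 'a"
    by (rule ln_eq)
  have int_phi: "integrable lborel (\<lambda>y. out y * ln (\<phi> y))"
    using output_power(1) by (subst distributed_integrable[OF distributed_out]) (auto simp: nonneg ln_phi)
  have "a - b * ((\<integral>x. (norm x)\<^sup>2 \<partial>mu) + V) = (\<integral>z. a - b * (norm (fst z + snd z))\<^sup>2 \<partial>joint)"
    using output_power by (simp add: joint.prob_space)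
  also have "\<dots> = (\<integral>y. out y * ln (\<phi> y) \<partial>lborel)"
    by (subst distributed_integral[OF distributed_out]) (auto simp: nonneg ln_phi)
  also have "\<dots> \<le> (\<integral>y. out y * ln (out y) + (\<phi> y - out y * 1) \<partial>lborel)"
    using gibbs_pointwise[OF out_pos pos]
    by (intro integral_mono int_phi Bochner_Integration.integrable_add Bochner_Integration.integrable_diff
        int_ln int_out phi) auto
  also have "\<dots> = (\<integral>y. out y * ln (out y) \<partial>lborel) + ((\<integral>y. \<phi> y \<partial>lborel) - (\<integral>y. out y * 1 \<partial>lborel))"
    by (subst Bochner_Integration.integral_add[OF int_ln Bochner_Integration.integrable_diff[OF phi(1) int_out]])
       (subst Bochner_Integration.integral_diff[OF phi(1) int_out], rule refl)
  finally show ?thesis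
    unfolding phi total_out by simp
qed

end

section \<open>Gaussian densities\<close>

text \<open>The product form reduces integrals to one coordinate at a time. Here
  \<open>\<sigma>\<close> is the standard deviation per coordinate, so the second moment of the norm
  grows with the dimension.\<close>

definition gauss :: "real \<Rightarrow> 'a::euclidean_space \<Rightarrow> real" where
  "gauss \<sigma> x = (\<Prod>b\<in>Basis. normal_density 0 \<sigma> (x \<bullet> b))"

lemma gauss_eq:
  fixes x :: "'a::euclidean_space"
  shows "gauss \<sigma> x = (1 / sqrt (2 * pi * \<sigma>\<^sup>2)) ^ DIM('a) * exp (- (1 / (2 * \<sigma>\<^sup>2)) * (norm x)\<^sup>2)"
proof -
  have "(norm x)\<^sup>2 = (\<Sum>b\<in>Basis. (x \<bullet> b)\<^sup>2)"
    unfolding power2_norm_eq_inner by (subst euclidean_inner) (simp add: power2_eq_square)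
  then have "exp (- (1 / (2 * \<sigma>\<^sup>2)) * (norm x)\<^sup>2) = (\<Prod>b\<in>Basis. exp (- (x \<bullet> b)\<^sup>2 / (2 * \<sigma>\<^sup>2)))"
    by (simp add: exp_sum[symmetric] sum_distrib_left sum_negf)
  then show ?thesis
    by (simp add: gauss_def normal_density_def prod_dividef power_divide)
qed

lemma measurable_gauss [measurable]: "gauss \<sigma> \<in> borel_measurable borel"
  unfolding gauss_def by measurable

lemma nn_integral_gauss:
  fixes \<sigma> :: real
  assumes "0 < \<sigma>"
  shows "(\<integral>\<^sup>+x. ennreal (gauss \<sigma> (x :: 'a::euclidean_space)) \<partial>lborel) = 1"
proof -
  have "(\<integral>\<^sup>+t. ennreal (normal_density 0 \<sigma> t) \<partial>lborel) = 1"
    using assms by (subst nn_integral_eq_integral) auto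
  then show ?thesis
    unfolding gauss_def
    using nn_integral_lborel_prod[of "\<lambda>_ t. ennreal (normal_density 0 \<sigma> t)"]
    by (simp add: prod_ennreal[symmetric])
qed

lemma nn_integral_gauss_norm_squared:
  fixes \<sigma> :: real
  assumes "0 < \<sigma>"
  shows "(\<integral>\<^sup>+x. ennreal (gauss \<sigma> (x :: 'a::euclidean_space) * (norm x)\<^sup>2) \<partial>lborel) = ennreal (DIM('a) * \<sigma>\<^sup>2)"
proof -
  \<comment> \<open>The factor \<open>h i b\<close> carries the square only in coordinate
    \<open>i\<close>. Summing the products over \<open>i\<close> gives the squared norm, and each
    product integrates to a single variance.\<close>
  define h where "h i b t = ennreal (normal_density 0 \<sigma> t * (if b = i then t\<^sup>2 else 1))" for i b :: 'a and t
  have [measurable]: "h i b \<in> borel_measurable borel" for i b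
    unfolding h_def by measurable
  have one: "(\<integral>\<^sup>+t. ennreal (normal_density 0 \<sigma> t) \<partial>lborel) = 1"
    using assms by (subst nn_integral_eq_integral) auto
  have "has_bochner_integral lborel (\<lambda>t. normal_density 0 \<sigma> t * (t - 0) ^ (2 * 1)) (\<sigma>\<^sup>2)"
    using normal_moment_even[OF assms, of 0 1] by simp
  then have two: "(\<integral>\<^sup>+t. ennreal (normal_density 0 \<sigma> t * t\<^sup>2) \<partial>lborel) = ennreal (\<sigma>\<^sup>2)"
    by (subst nn_integral_eq_integral) (auto simp: has_bochner_integral_iff)
  have h_int: "(\<integral>\<^sup>+t. h i b t \<partial>lborel) = (if b = i then ennreal (\<sigma>\<^sup>2) else 1)" for i b
    by (simp add: h_def one two)
  have expand: "ennreal (gauss \<sigma> x * (norm x)\<^sup>2) = (\<Sum>i\<in>Basis. \<Prod>b\<in>Basis. h i b (x \<bullet> b))" for x :: 'a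
  proof -
    have norm: "(norm x)\<^sup>2 = (\<Sum>b\<in>Basis. (x \<bullet> b)\<^sup>2)"
      unfolding power2_norm_eq_inner by (subst euclidean_inner) (simp add: power2_eq_square)
    have prod: "(\<Prod>b\<in>Basis. h i b (x \<bullet> b)) = ennreal (gauss \<sigma> x * (x \<bullet> i)\<^sup>2)" if "i \<in> Basis" for i
      using that
      by (simp add: h_def prod_ennreal prod.distrib gauss_def prod.delta)
    show ?thesis
      unfolding norm sum_distrib_left
      by (simp add: prod sum_ennreal gauss_def prod_nonneg)
  qed
  have "(\<integral>\<^sup>+x. ennreal (gauss \<sigma> (x :: 'a) * (norm x)\<^sup>2) \<partial>lborel)
      = (\<Sum>i\<in>Basis. \<integral>\<^sup>+x. (\<Prod>b\<in>Basis. h i b (x \<bullet> b)) \<partial>lborel)"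
    unfolding expand by (rule nn_integral_sum) measurable
  also have "\<dots> = (\<Sum>i\<in>(Basis :: 'a set). \<Prod>b\<in>Basis. (if b = i then ennreal (\<sigma>\<^sup>2) else 1))"
    by (simp add: nn_integral_lborel_prod h_int)
  also have "\<dots> = ennreal (DIM('a) * \<sigma>\<^sup>2)"
    by (simp add: ennreal_mult ennreal_of_nat_eq_real_of_nat)
  finally show ?thesis .
qed

text \<open>Lets the Gaussian act as the noise of a channel. Its minorant is an equality, and the
  same constant, its value at the origin, is the maximum.\<close>

lemma noise_density_gauss:
  fixes \<sigma> :: real
  assumes "0 < \<sigma>"
  shows "noise_density (gauss \<sigma> :: 'a::euclidean_space \<Rightarrow> real) ((1 / sqrt (2 * pi * \<sigma>\<^sup>2)) ^ DIM('a)) (1 / (2 * \<sigma>\<^sup>2))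
    ((1 / sqrt (2 * pi * \<sigma>\<^sup>2)) ^ DIM('a)) (DIM('a) * \<sigma>\<^sup>2)"
proof
  fix x :: 'a
  show "(1 / sqrt (2 * pi * \<sigma>\<^sup>2)) ^ DIM('a) * exp (- (1 / (2 * \<sigma>\<^sup>2)) * (norm x)\<^sup>2) \<le> gauss \<sigma> x"
    by (simp add: gauss_eq)
  have "exp (- (1 / (2 * \<sigma>\<^sup>2)) * (norm x)\<^sup>2) \<le> 1" by simp
  then show "gauss \<sigma> x \<le> (1 / sqrt (2 * pi * \<sigma>\<^sup>2)) ^ DIM('a)"
    unfolding gauss_eq by (intro mult_left_le) auto
  show "gauss \<sigma> (- x) = gauss \<sigma> x"
    by (simp add: gauss_eq)
qed (use assms nn_integral_gauss nn_integral_gauss_norm_squared in auto)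

lemma ln_gauss:
  fixes x :: "'a::euclidean_space" and \<sigma> :: real
  assumes "0 < \<sigma>"
  shows "ln (gauss \<sigma> x) = - (DIM('a) / 2 * ln (2 * pi * \<sigma>\<^sup>2)) - 1 / (2 * \<sigma>\<^sup>2) * (norm x)\<^sup>2"
proof -
  have "ln (gauss \<sigma> x) = DIM('a) * ln (1 / sqrt (2 * pi * \<sigma>\<^sup>2)) - 1 / (2 * \<sigma>\<^sup>2) * (norm x)\<^sup>2"
    unfolding gauss_eq using assms by (subst ln_mult) (auto simp: ln_realpow)
  also have "ln (1 / sqrt (2 * pi * \<sigma>\<^sup>2)) = - (ln (2 * pi * \<sigma>\<^sup>2) / 2)"
    using assms by (simp add: ln_div ln_sqrt)
  finally show ?thesis by simp
qed

section \<open>The Bessel function and the noise density\<close>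

text \<open>Quadratic growth is enough to dominate the Bessel kernel by a Gaussian.\<close>

lemma cosh_ge_quadratic: "t\<^sup>2 / 4 \<le> cosh (t :: real)"
proof -
  have "1 + \<bar>t\<bar> + \<bar>t\<bar>\<^sup>2 / 2 \<le> exp \<bar>t\<bar>"
    by (rule exp_lower_Taylor_quadratic) simp
  moreover have "exp \<bar>t\<bar> / 2 \<le> cosh \<bar>t\<bar>"
    by (simp add: cosh_field_def)
  moreover have "cosh \<bar>t\<bar> = cosh t"
    by (simp add: abs_if)
  ultimately show ?thesis by simp
qed

lemma measurable_cosh_real [measurable]: "(cosh :: real \<Rightarrow> real) \<in> borel_measurable borel"
  by (intro borel_measurable_continuous_onI continuous_intros)

lemma exp_mult_cosh:
  fixes a \<nu> t :: real
  shows "exp a * cosh (\<nu> * t) = (exp (a + \<nu> * t) + exp (a + (- \<nu>) * t)) / 2"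
  by (simp add: cosh_field_def[of "\<nu> * t"] exp_add[symmetric] distrib_left)

lemma integrable_bessel_kernel:
  fixes x \<nu> :: real
  assumes "0 < x"
  shows "integrable lborel (\<lambda>t. exp (- x * cosh t + \<nu> * t))"
proof (rule Bochner_Integration.integrable_bound)
  \<comment> \<open>Mean and variance come from completing the square: \<open>- x t^2 / 4 + \<nu> t
    = \<nu>^2 / x - (x / 4) (t - 2 \<nu> / x)^2\<close>. The factor \<open>K\<close> restores
    \<open>exp (\<nu>^2 / x)\<close> and undoes the Gaussian normalisation.\<close>
  define K where "K = sqrt (2 * pi * (sqrt (2 / x))\<^sup>2) * exp (\<nu>\<^sup>2 / x)"
  show "integrable lborel (\<lambda>t. K * normal_density (2 * \<nu> / x) (sqrt (2 / x)) t)"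
    using assms by (intro integrable_mult_right integrable_normal_density) simp
  have "exp (- x * cosh t + \<nu> * t) \<le> K * normal_density (2 * \<nu> / x) (sqrt (2 / x)) t" for t
  proof -
    have "x * (t\<^sup>2 / 4) \<le> x * cosh t"
      using cosh_ge_quadratic assms by (intro mult_left_mono) auto
    then have "exp (- x * cosh t + \<nu> * t) \<le> exp (- x * (t\<^sup>2 / 4) + \<nu> * t)"
      by simp
    also have "- x * (t\<^sup>2 / 4) + \<nu> * t = \<nu>\<^sup>2 / x + - (t - 2 * \<nu> / x)\<^sup>2 / (2 * (sqrt (2 / x))\<^sup>2)"
      using assms by (simp add: field_simps power2_eq_square)
    also have "exp \<dots> = K * normal_density (2 * \<nu> / x) (sqrt (2 / x)) t"
      using assms by (simp add: K_def normal_density_def exp_add[symmetric] field_simps)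
    finally show ?thesis .
  qed
  then show "AE t in lborel. norm (exp (- x * cosh t + \<nu> * t)) \<le> norm (K * normal_density (2 * \<nu> / x) (sqrt (2 / x)) t)"
    by (intro AE_I2) (simp add: K_def)
qed simp

text \<open>The kernel is even in \<open>t\<close>, so extending it to the whole line doubles the
  integral and makes affine substitutions available.\<close>

lemma besselK_even_kernel:
  fixes x \<nu> :: real
  assumes "0 < x"
  shows "has_bochner_integral lborel (\<lambda>t. exp (- x * cosh t) * cosh (\<nu> * t)) (2 * besselK \<nu> x)"
proof -
  have "integrable lborel (\<lambda>t. exp (- x * cosh t) * cosh (\<nu> * t))"
    unfolding exp_mult_cosh
    by (intro integrable_divide Bochner_Integration.integrable_add integrable_bessel_kernel assms)
  then have "set_integrable lborel {0..} (\<lambda>t. exp (- x * cosh t) * cosh (\<nu> * t))"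
    unfolding set_integrable_def by (rule integrable_mult_indicator[rotated]) simp
  then have "has_bochner_integral lborel (\<lambda>t. indicator {0..} t *\<^sub>R (exp (- x * cosh t) * cosh (\<nu> * t))) (besselK \<nu> x)"
    unfolding set_integrable_def besselK_def set_lebesgue_integral_def by (rule has_bochner_integral_integrable)
  from has_bochner_integral_even_function[OF this] show ?thesis by simp
qed

lemma besselK_eq_integral:
  fixes x \<nu> :: real
  assumes "0 < x"
  shows "(\<integral>t. exp (- x * cosh t + \<nu> * t) \<partial>lborel) = 2 * besselK \<nu> x"
proof -
  let ?G = "\<lambda>\<nu> t. exp (- x * cosh t + \<nu> * t)"
  \<comment> \<open>The two exponentials in \<open>cosh (\<nu> * t)\<close> contribute equally, by
    the reflection \<open>t \<mapsto> - t\<close>.\<close>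
  have flip: "(\<integral>t. ?G (- \<nu>) t \<partial>lborel) = (\<integral>t. ?G \<nu> t \<partial>lborel)"
    by (subst lborel_integral_real_affine[of "-1" _ 0]) auto
  have "2 * besselK \<nu> x = (\<integral>t. exp (- x * cosh t) * cosh (\<nu> * t) \<partial>lborel)"
    using besselK_even_kernel[OF assms] by (simp add: has_bochner_integral_iff)
  also have "\<dots> = (\<integral>t. (?G \<nu> t + ?G (- \<nu>) t) / 2 \<partial>lborel)"
    unfolding exp_mult_cosh ..
  also have "\<dots> = ((\<integral>t. ?G \<nu> t \<partial>lborel) + (\<integral>t. ?G (- \<nu>) t \<partial>lborel)) / 2"
    using integrable_bessel_kernel[OF assms, of \<nu>] integrable_bessel_kernel[OF assms, of "- \<nu>"]
    by (simp del: mult_minus_left mult_minus_right)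
  finally show ?thesis unfolding flip by simp
qed

text \<open>The substitution \<open>t = ln \<rho> - s\<close> frees the kernel of square roots: \<open>\<rho>\<close> enters only through \<open>\<rho>\<^sup>2\<close>.\<close>

lemma besselK_mixture:
  fixes u \<rho> \<nu> :: real
  assumes "0 < u" "0 < \<rho>"
  shows "has_bochner_integral lborel (\<lambda>s. exp (- (u / 2) * (\<rho>\<^sup>2 * exp (- s) + exp s) - \<nu> * s))
    (2 * \<rho> powr (- \<nu>) * besselK \<nu> (u * \<rho>))"
proof -
  let ?G = "\<lambda>t. exp (- (u * \<rho>) * cosh t + \<nu> * t)"
  have pos: "0 < u * \<rho>" using assms by simp
  have "has_bochner_integral lborel ?G (2 * besselK \<nu> (u * \<rho>))"
    using integrable_bessel_kernel[OF pos] besselK_eq_integral[OF pos] by (simp add: has_bochner_integral_iff)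
  then have "has_bochner_integral lborel (\<lambda>s. ?G (ln \<rho> + (- 1) * s)) (2 * besselK \<nu> (u * \<rho>))"
    by (subst (asm) lborel_has_bochner_integral_real_affine_iff[of "-1" _ _ "ln \<rho>"]) auto
  then have "has_bochner_integral lborel (\<lambda>s. \<rho> powr (- \<nu>) * ?G (ln \<rho> + (- 1) * s)) (\<rho> powr (- \<nu>) * (2 * besselK \<nu> (u * \<rho>)))"
    by (intro has_bochner_integral_mult_right) auto
  moreover have "\<rho> powr (- \<nu>) * ?G (ln \<rho> + (- 1) * s) = exp (- (u / 2) * (\<rho>\<^sup>2 * exp (- s) + exp s) - \<nu> * s)" for s
  proof -
    have "cosh (ln \<rho> + (- 1) * s) = (\<rho> * exp (- s) + exp s / \<rho>) / 2"
      using assms by (simp add: cosh_field_def exp_diff exp_minus field_simps)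
    then have "- (u * \<rho>) * cosh (ln \<rho> + (- 1) * s) = - (u / 2) * (\<rho>\<^sup>2 * exp (- s) + exp s)"
      unfolding power2_eq_square using assms(2) by (simp only:) (simp add: field_simps)
    moreover have "\<rho> powr (- \<nu>) = exp (- \<nu> * ln \<rho>)"
      using assms by (simp add: powr_def)
    ultimately show ?thesis
      by (simp add: exp_add[symmetric] algebra_simps)
  qed
  ultimately show ?thesis by (simp add: mult.left_commute mult.assoc)
qed

lemma besselK_minus: "besselK (- \<nu>) x = besselK \<nu> x"
  by (simp add: besselK_def)

text \<open>Substituting \<open>v = sinh (t / 2)\<close> turns the kernel of order one half into a Gaussian.\<close>

lemma besselK_half:
  fixes x :: real
  assumes "0 < x"
  shows "besselK (1 / 2) x = sqrt (pi / (2 * x)) * exp (- x)"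
proof -
  \<comment> \<open>Since \<open>cosh t = 1 + 2 sinh(t / 2)^2\<close>, the substituted exponent is
    \<open>- x - 2 x v^2\<close>, a Gaussian of variance \<open>1 / (4 x)\<close>.\<close>
  define \<sigma> where "\<sigma> = sqrt (1 / (4 * x))"
  have \<sigma>: "0 < \<sigma>" "\<sigma>\<^sup>2 = 1 / (4 * x)"
    using assms by (auto simp: \<sigma>_def)
  let ?C = "2 * sqrt (pi / (2 * x)) * exp (- x)"
  define F where "F v = ?C * normal_density 0 \<sigma> v" for v
  have F_eq: "F v = 2 * exp (- x - 2 * x * v\<^sup>2)" for v
  proof -
    have "sqrt (2 * pi * \<sigma>\<^sup>2) = sqrt (pi / (2 * x))"
      by (simp add: \<sigma>)
    then show ?thesis
      using assms by (simp add: F_def normal_density_def \<sigma>(2) exp_diff exp_minus field_simps)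
  qed
  have int_F: "integrable lborel F" and F_val: "(\<integral>v. F v \<partial>lborel) = ?C"
    unfolding F_def using \<sigma> by auto
  have F_abs: "F absolutely_integrable_on UNIV"
    using integrable_on_lborel[OF int_F] by (rule nonnegative_absolutely_integrable_1) (simp add: F_eq)
  have range: "(\<lambda>t. sinh (t / 2) :: real) ` UNIV = UNIV"
    by (rule surjI[where f="\<lambda>v. 2 * arsinh v"]) simp
  have kernel: "\<bar>cosh (t / 2) / 2\<bar> * F (sinh (t / 2)) = exp (- x * cosh t) * cosh (1 / 2 * t)" for t
  proof -
    have "cosh t = 2 * (sinh (t / 2))\<^sup>2 + 1"
      using cosh_double[of "t / 2"] cosh_square_eq[of "t / 2"] by simp
    then have "- x - 2 * x * (sinh (t / 2))\<^sup>2 = - x * cosh t"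
      by (simp add: algebra_simps)
    then show ?thesis by (simp add: F_eq)
  qed
  have "(\<lambda>t. \<bar>cosh (t / 2) / 2\<bar> * F (sinh (t / 2))) absolutely_integrable_on UNIV \<and>
      integral UNIV (\<lambda>t. \<bar>cosh (t / 2) / 2\<bar> * F (sinh (t / 2))) = ?C"
  proof (rule has_absolute_integral_change_of_variables_1'[where g="\<lambda>t. sinh (t / 2)", THEN iffD2])
    show "((\<lambda>t. sinh (t / 2)) has_field_derivative cosh (t / 2) / 2) (at t within UNIV)" for t :: real
      by (auto intro!: derivative_eq_intros)
    show "inj (\<lambda>t::real. sinh (t / 2))"
      by (auto simp: inj_def)
    show "F absolutely_integrable_on range (\<lambda>t. sinh (t / 2)) \<and> integral (range (\<lambda>t. sinh (t / 2))) F = ?C"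
      unfolding range using F_abs integral_lborel[OF int_F] F_val by simp
  qed simp
  then have "integral UNIV (\<lambda>t. exp (- x * cosh t) * cosh (1 / 2 * t)) = ?C"
    unfolding kernel by simp
  moreover have "integral UNIV (\<lambda>t. exp (- x * cosh t) * cosh (1 / 2 * t)) = 2 * besselK (1 / 2) x"
    using besselK_even_kernel[OF assms, of "1 / 2"]
    by (subst integral_lborel) (auto simp: has_bochner_integral_iff)
  ultimately show ?thesis by simp
qed

section \<open>The noise law as a scale mixture of Gaussians\<close>

text \<open>Up to constants, the noise density is \<open>\<integral>s. mixing_kernel u \<nu> ((norm n)\<^sup>2 + lam\<^sup>2) s\<close>,
  a scale mixture of centred Gaussians of variance \<open>exp s / u\<close>.\<close>

definition mixing_kernel :: "real \<Rightarrow> real \<Rightarrow> real \<Rightarrow> real \<Rightarrow> real" where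
  "mixing_kernel u \<nu> q s = exp (- (u / 2) * (q * exp (- s) + exp s) - \<nu> * s)"

lemma measurable_mixing_kernel [measurable]:
  "(\<lambda>(q, s). mixing_kernel u \<nu> q s) \<in> borel_measurable (borel \<Otimes>\<^sub>M borel)"
  unfolding mixing_kernel_def by measurable

lemma mixing_kernel_nonneg [simp]: "0 \<le> mixing_kernel u \<nu> q s"
  by (simp add: mixing_kernel_def)

text \<open>The part of the noise density that is free of \<open>n\<close>. Halving offsets the
  factor 2 in \<open>integral_mixing_kernel\<close>.\<close>

definition mixing_const :: "real \<Rightarrow> real \<Rightarrow> real \<Rightarrow> real" where
  "mixing_const lam u \<nu> = lam / (2 powr (\<nu> - 1) * pi powr \<nu>) * u powr \<nu> * exp (lam * u) / 2"

lemma integral_mixing_kernel: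
  assumes "0 < u" "0 < \<rho>"
  shows "integrable lborel (mixing_kernel u \<nu> (\<rho>\<^sup>2))"
    and "(\<integral>s. mixing_kernel u \<nu> (\<rho>\<^sup>2) s \<partial>lborel) = 2 * \<rho> powr (- \<nu>) * besselK \<nu> (u * \<rho>)"
  using besselK_mixture[OF assms, of \<nu>] unfolding mixing_kernel_def[abs_def] by (auto simp: has_bochner_integral_iff)

lemma ndfhl_density_mixture:
  fixes n :: "real ^ 'p" and lam u :: real
  defines "\<nu> \<equiv> (real CARD('p) + 1) / 2"
  assumes "0 < lam" "0 < u"
  shows "integrable lborel (mixing_kernel u \<nu> ((norm n)\<^sup>2 + lam\<^sup>2))"
    and "ndfhl_density lam u n
      = mixing_const lam u \<nu> * (\<integral>s. mixing_kernel u \<nu> ((norm n)\<^sup>2 + lam\<^sup>2) s \<partial>lborel)"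
proof -
  define \<rho> where "\<rho> = sqrt ((norm n)\<^sup>2 + lam\<^sup>2)"
  have pos: "0 < (norm n)\<^sup>2 + lam\<^sup>2"
    using assms by (simp add: add_nonneg_pos)
  then have \<rho>: "0 < \<rho>" "\<rho>\<^sup>2 = (norm n)\<^sup>2 + lam\<^sup>2"
    by (auto simp: \<rho>_def)
  show "integrable lborel (mixing_kernel u \<nu> ((norm n)\<^sup>2 + lam\<^sup>2))"
    using integral_mixing_kernel(1)[OF \<open>0 < u\<close> \<rho>(1), of \<nu>] by (simp add: \<rho>)
  have "(u / \<rho>) powr \<nu> = u powr \<nu> * \<rho> powr (- \<nu>)"
    using \<open>0 < u\<close> \<rho>(1) by (simp add: powr_def ln_div exp_add[symmetric] algebra_simps)
  then have "ndfhl_density lam u n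
      = mixing_const lam u \<nu> * (2 * \<rho> powr (- \<nu>) * besselK \<nu> (u * \<rho>))"
    by (simp add: ndfhl_density_def mixing_const_def \<nu>_def Let_def \<rho>_def[symmetric])
  then show "ndfhl_density lam u n
      = mixing_const lam u \<nu> * (\<integral>s. mixing_kernel u \<nu> ((norm n)\<^sup>2 + lam\<^sup>2) s \<partial>lborel)"
    using integral_mixing_kernel(2)[OF \<open>0 < u\<close> \<rho>(1), of \<nu>] by (simp add: \<rho>)
qed

text \<open>With \<open>p\<close> the dimension, \<open>exp (- (p + 1) s / 2)\<close> splits into
  \<open>exp (- p s / 2)\<close>, which normalises a Gaussian of variance \<open>exp s / u\<close>,
  and \<open>exp (- s / 2)\<close>, which leaves a kernel of order one half whatever the
  dimension.\<close>

lemma mixing_kernel_gauss: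
  fixes n :: "'a::euclidean_space" and lam u :: real
  assumes "0 < u"
  shows "mixing_kernel u ((real DIM('a) + 1) / 2) ((norm n)\<^sup>2 + lam\<^sup>2) s
    = (2 * pi / u) powr (DIM('a) / 2) * mixing_kernel u (1 / 2) (lam\<^sup>2) s * gauss (sqrt (exp s / u)) n"
proof -
  define p where "p = DIM('a)"
  have sq: "(sqrt (exp s / u))\<^sup>2 = exp s / u"
    using assms by simp
  have "0 < 2 * pi / u * exp s" using assms by simp
  then have "(1 / sqrt (2 * pi / u * exp s)) ^ p = ((2 * pi / u * exp s) powr (- (1 / 2))) ^ p"
    by (simp add: powr_minus_divide powr_half_sqrt)
  also have "\<dots> = (2 * pi / u * exp s) powr (- (real p / 2))"
    using \<open>0 < 2 * pi / u * exp s\<close> by (subst powr_power) auto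
  also have "\<dots> = (2 * pi / u) powr (- (real p / 2)) * exp (- (real p / 2) * s)"
    using assms by (subst powr_mult) (auto simp: exp_powr_real mult.commute)
  finally have norm: "(1 / sqrt (2 * pi * (exp s / u))) ^ p
      = (2 * pi / u) powr (- (real p / 2)) * exp (- (real p / 2) * s)"
    by simp
  have "(2 * pi / u) powr (real p / 2) * (2 * pi / u) powr (- (real p / 2)) = 1"
    using assms by (simp add: powr_minus)
  then have "(2 * pi / u) powr (real p / 2) * mixing_kernel u (1 / 2) (lam\<^sup>2) s * gauss (sqrt (exp s / u)) n
      = mixing_kernel u (1 / 2) (lam\<^sup>2) s * (exp (- (real p / 2) * s) * exp (- (1 / (2 * (exp s / u))) * (norm n)\<^sup>2))"
    unfolding gauss_eq sq p_def[symmetric] norm by simp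
  also have "1 / (2 * (exp s / u)) = u / 2 * exp (- s)"
    by (simp add: exp_minus field_simps)
  also have "mixing_kernel u (1 / 2) (lam\<^sup>2) s * (exp (- (real p / 2) * s) * exp (- (u / 2 * exp (- s)) * (norm n)\<^sup>2))
      = mixing_kernel u ((real p + 1) / 2) ((norm n)\<^sup>2 + lam\<^sup>2) s"
    by (simp add: mixing_kernel_def exp_add[symmetric] algebra_simps add_divide_distrib)
  finally show ?thesis by (simp add: p_def)
qed

text \<open>This product is the total mass left once \<open>n\<close> has been integrated out. By
  \<open>besselK_half\<close> it consists of powers of \<open>lam\<close>, 2, \<open>pi\<close> and
  \<open>u\<close> and two opposite exponentials.\<close>

lemma mixing_const_normalises:
  fixes lam u :: real
  assumes "0 < lam" "0 < u"
  shows "mixing_const lam u ((real p + 1) / 2) * (2 * pi / u) powr (real p / 2)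
    * (2 * lam powr (- (1 / 2)) * besselK (1 / 2) (u * lam)) = 1"
proof -
  have powr: "(pi / (2 * (u * lam))) powr e = pi powr e * 2 powr (- e) * u powr (- e) * lam powr (- e)" for e
    using assms by (simp add: powr_def ln_div ln_mult exp_add[symmetric] algebra_simps)
  have b: "besselK (1 / 2) (u * lam) = pi powr (1 / 2) * 2 powr (- (1 / 2)) * u powr (- (1 / 2)) * lam powr (- (1 / 2)) * exp (- (lam * u))"
    using assms powr[of "1 / 2"] powr_half_sqrt[of "pi / (2 * (u * lam))"]
    by (simp add: besselK_half mult.commute[of lam u])
  have q: "(2 * pi / u) powr (real p / 2) = 2 powr (real p / 2) * pi powr (real p / 2) * u powr (- (real p / 2))"
    using assms by (simp add: powr_def ln_div ln_mult exp_add[symmetric] algebra_simps)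
  have c: "mixing_const lam u ((real p + 1) / 2) = lam powr 1 * 2 powr (1 - (real p + 1) / 2) * pi powr (- ((real p + 1) / 2))
      * u powr ((real p + 1) / 2) * exp (lam * u) * 2 powr (- 1)"
  proof -
    have "2 powr (1 - (real p + 1) / 2) = 1 / 2 powr ((real p + 1) / 2 - 1)"
      using powr_minus_divide[of 2 "(real p + 1) / 2 - 1"] by (simp only: minus_diff_eq)
    moreover have "pi powr (- ((real p + 1) / 2)) = 1 / pi powr ((real p + 1) / 2)"
      by (rule powr_minus_divide)
    ultimately show ?thesis
      using assms(1) by (simp only: mixing_const_def powr_neg_one) simp
  qed
  \<comment> \<open>Grouped by base, with plain factors written as \<open>powr 1\<close>, the
    exponents of each base add up to zero.\<close>
  have "mixing_const lam u ((real p + 1) / 2) * (2 * pi / u) powr (real p / 2)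
    * (2 powr 1 * lam powr (- (1 / 2)) * besselK (1 / 2) (u * lam))
    = (lam powr 1 * lam powr (- (1 / 2)) * lam powr (- (1 / 2)))
      * (2 powr (1 - (real p + 1) / 2) * 2 powr (- 1) * 2 powr (real p / 2) * 2 powr 1 * 2 powr (- (1 / 2)))
      * (pi powr (- ((real p + 1) / 2)) * pi powr (real p / 2) * pi powr (1 / 2))
      * (u powr ((real p + 1) / 2) * u powr (- (real p / 2)) * u powr (- (1 / 2)))
      * (exp (lam * u) * exp (- (lam * u)))"
    unfolding b q c by (simp only: mult_ac)
  also have "lam powr 1 * lam powr (- (1 / 2)) * lam powr (- (1 / 2)) = 1"
    using assms by (simp only: powr_add[symmetric]) simp
  also have "2 powr (1 - (real p + 1) / 2) * 2 powr (- 1) * 2 powr (real p / 2) * 2 powr 1 * 2 powr (- (1 / 2)) = (1 :: real)"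
    by (simp only: powr_add[symmetric]) (simp add: add_divide_distrib)
  also have "pi powr (- ((real p + 1) / 2)) * pi powr (real p / 2) * pi powr (1 / 2) = 1"
    by (simp only: powr_add[symmetric]) (simp add: add_divide_distrib)
  also have "u powr ((real p + 1) / 2) * u powr (- (real p / 2)) * u powr (- (1 / 2)) = 1"
    using assms by (simp only: powr_add[symmetric]) (simp add: add_divide_distrib)
  finally show ?thesis by (simp add: exp_minus)
qed

text \<open>Mass and second moment come from exchanging the integrals over \<open>n\<close> and
  \<open>s\<close>, the bounds from pointwise estimates of the mixing kernel.\<close>

lemma noise_density_ndfhl:
  fixes lam u :: real
  assumes "0 < lam" "0 < u"
  shows "\<exists>c k B V. noise_density (ndfhl_density lam u :: real ^ 'p \<Rightarrow> real) c k B V"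
proof -
  define p where "p = CARD('p)"
  have p: "p = DIM(real ^ 'p)" by (simp add: p_def)
  define \<nu> where "\<nu> = (real p + 1) / 2"
  define K where "K = mixing_const lam u \<nu>"
  define D where "D = (2 * pi / u) powr (real p / 2)"
  let ?f = "ndfhl_density lam u :: real ^ 'p \<Rightarrow> real"
  let ?W = "\<lambda>n :: real ^ 'p. mixing_kernel u \<nu> ((norm n)\<^sup>2 + lam\<^sup>2)"
  have K: "0 < K" using assms by (simp add: K_def mixing_const_def)
  have D: "0 < D" using assms by (simp add: D_def)
  have int_W: "integrable lborel (?W n)" for n
    using ndfhl_density_mixture(1)[OF assms, of n] by (simp add: \<nu>_def p_def)
  have f_eq: "?f n = K * (\<integral>s. ?W n s \<partial>lborel)" for n
    using ndfhl_density_mixture(2)[OF assms, of n] by (simp add: \<nu>_def p_def K_def)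
  have [measurable]: "(\<lambda>z. ?W (fst z) (snd z)) \<in> borel_measurable (borel \<Otimes>\<^sub>M borel)"
    unfolding mixing_kernel_def by measurable
  have [measurable]: "?f \<in> borel_measurable borel"
    unfolding f_eq by measurable
  have W_eq: "?W n s = D * mixing_kernel u (1 / 2) (lam\<^sup>2) s * gauss (sqrt (exp s / u)) n" for n s
    using mixing_kernel_gauss[OF \<open>0 < u\<close>, of n lam s] by (simp add: p \<nu>_def D_def)
  have f_nn: "ennreal (?f n) = ennreal K * (\<integral>\<^sup>+s. ennreal (?W n s) \<partial>lborel)" for n
    unfolding f_eq using K int_W by (simp add: nn_integral_eq_integral ennreal_mult)
  \<comment> \<open>The weight \<open>w\<close> is kept general: \<open>w = 1\<close> yields the
    mass, the squared norm yields the second moment. After the exchange the inner integral is purely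
    Gaussian.\<close>
  have tonelli: "(\<integral>\<^sup>+n. ennreal (?f n * w n) \<partial>lborel)
      = ennreal (K * D) * (\<integral>\<^sup>+s. ennreal (mixing_kernel u (1 / 2) (lam\<^sup>2) s)
          * (\<integral>\<^sup>+n. ennreal (gauss (sqrt (exp s / u)) n * w n) \<partial>lborel) \<partial>lborel)"
    if [measurable]: "w \<in> borel_measurable borel" and w: "\<And>n. 0 \<le> w n" for w :: "real ^ 'p \<Rightarrow> real"
  proof -
    have "(\<integral>\<^sup>+n. ennreal (?f n * w n) \<partial>lborel) = (\<integral>\<^sup>+n. \<integral>\<^sup>+s. ennreal K * ennreal (?W n s * w n) \<partial>lborel \<partial>lborel)"
    proof (rule nn_integral_cong)
      fix n
      have "ennreal (?f n * w n) = ennreal (w n) * (ennreal K * (\<integral>\<^sup>+s. ennreal (?W n s) \<partial>lborel))"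
        unfolding f_nn[symmetric] using w by (simp add: ennreal_mult'[symmetric] mult.commute)
      also have "\<dots> = (\<integral>\<^sup>+s. ennreal (w n) * (ennreal K * ennreal (?W n s)) \<partial>lborel)"
        by (simp add: nn_integral_cmult)
      also have "\<dots> = (\<integral>\<^sup>+s. ennreal K * ennreal (?W n s * w n) \<partial>lborel)"
        using w by (intro nn_integral_cong) (simp add: ennreal_mult'' mult_ac)
      finally show "ennreal (?f n * w n) = (\<integral>\<^sup>+s. ennreal K * ennreal (?W n s * w n) \<partial>lborel)" .
    qed
    also have "\<dots> = (\<integral>\<^sup>+s. \<integral>\<^sup>+n. ennreal K * ennreal (?W n s * w n) \<partial>lborel \<partial>lborel)"
      by (rule lborel_pair.Fubini') measurable
    also have "\<dots> = (\<integral>\<^sup>+s. ennreal (K * D) * (ennreal (mixing_kernel u (1 / 2) (lam\<^sup>2) s)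
          * (\<integral>\<^sup>+n. ennreal (gauss (sqrt (exp s / u)) n * w n) \<partial>lborel)) \<partial>lborel)"
    proof (rule nn_integral_cong)
      fix s :: real
      have "ennreal K * ennreal (?W n s * w n)
          = ennreal (K * D) * ennreal (mixing_kernel u (1 / 2) (lam\<^sup>2) s) * ennreal (gauss (sqrt (exp s / u)) n * w n)" for n
        unfolding W_eq using K D w
        by (simp add: ennreal_mult[symmetric] gauss_def prod_nonneg mult_ac)
      then show "(\<integral>\<^sup>+n. ennreal K * ennreal (?W n s * w n) \<partial>lborel)
          = ennreal (K * D) * (ennreal (mixing_kernel u (1 / 2) (lam\<^sup>2) s)
          * (\<integral>\<^sup>+n. ennreal (gauss (sqrt (exp s / u)) n * w n) \<partial>lborel))"
        by (simp add: nn_integral_cmult mult.assoc)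
    qed
    also have "\<dots> = ennreal (K * D) * (\<integral>\<^sup>+s. ennreal (mixing_kernel u (1 / 2) (lam\<^sup>2) s)
          * (\<integral>\<^sup>+n. ennreal (gauss (sqrt (exp s / u)) n * w n) \<partial>lborel) \<partial>lborel)"
      unfolding gauss_def normal_density_def by (rule nn_integral_cmult) measurable
    finally show ?thesis .
  qed
  have \<sigma>: "0 < sqrt (exp s / u)" for s using assms by simp
  have half: "(\<integral>\<^sup>+s. ennreal (mixing_kernel u a (lam\<^sup>2) s) \<partial>lborel) = ennreal (2 * lam powr (- a) * besselK a (u * lam))" for a
    using integral_mixing_kernel[OF \<open>0 < u\<close> \<open>0 < lam\<close>, of a] by (subst nn_integral_eq_integral) auto
  have K_half: "0 \<le> besselK (1 / 2) (u * lam)"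
    using assms by (subst besselK_half) auto
  have total: "(\<integral>\<^sup>+n. ennreal (?f n) \<partial>lborel) = 1"
  proof -
    have "(\<integral>\<^sup>+n. ennreal (?f n) \<partial>lborel) = ennreal (K * D) * ennreal (2 * lam powr (- (1 / 2)) * besselK (1 / 2) (u * lam))"
      using tonelli[of "\<lambda>_. 1"] by (simp add: nn_integral_gauss[OF \<sigma>] half)
    also have "\<dots> = ennreal (K * D * (2 * lam powr (- (1 / 2)) * besselK (1 / 2) (u * lam)))"
      using K D K_half by (intro ennreal_mult[symmetric]) auto
    also have "\<dots> = 1"
      using mixing_const_normalises[OF assms, of p] by (simp add: K_def D_def \<nu>_def)
    finally show ?thesis .
  qed
  \<comment> \<open>The Gaussian at \<open>s\<close> has second moment \<open>p * exp s / u\<close>.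
    The factor \<open>exp s\<close> shifts the order from \<open>1 / 2\<close> to
    \<open>- 1 / 2\<close>, and the Bessel function is even in its order, so the half-order value
    serves again.\<close>
  define V where "V = K * D * (real p / u * (2 * lam powr (1 / 2) * besselK (1 / 2) (u * lam)))"
  have moment: "(\<integral>\<^sup>+n. ennreal (?f n * (norm n)\<^sup>2) \<partial>lborel) = ennreal V"
  proof -
    have "(\<integral>\<^sup>+n. ennreal (?f n * (norm n)\<^sup>2) \<partial>lborel)
      = ennreal (K * D) * (\<integral>\<^sup>+s. ennreal (mixing_kernel u (1 / 2) (lam\<^sup>2) s) * ennreal (real p * (sqrt (exp s / u))\<^sup>2) \<partial>lborel)"
      by (subst tonelli) (auto simp: nn_integral_gauss_norm_squared[OF \<sigma>] p simp del: real_sqrt_pow2)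
    also have "\<dots> = ennreal (K * D) * (\<integral>\<^sup>+s. ennreal (real p / u) * ennreal (mixing_kernel u (- (1 / 2)) (lam\<^sup>2) s) \<partial>lborel)"
    proof -
      have "mixing_kernel u (1 / 2) (lam\<^sup>2) s * exp s = mixing_kernel u (- (1 / 2)) (lam\<^sup>2) s" for s
        by (simp add: mixing_kernel_def exp_add[symmetric])
      then have "mixing_kernel u (1 / 2) (lam\<^sup>2) s * (real p * (sqrt (exp s / u))\<^sup>2) = real p / u * mixing_kernel u (- (1 / 2)) (lam\<^sup>2) s" for s
        using assms by (simp add: field_simps)
      then have "ennreal (mixing_kernel u (1 / 2) (lam\<^sup>2) s) * ennreal (real p * (sqrt (exp s / u))\<^sup>2)
        = ennreal (real p / u) * ennreal (mixing_kernel u (- (1 / 2)) (lam\<^sup>2) s)" for s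
        using assms by (simp add: ennreal_mult[symmetric] del: real_sqrt_pow2)
      then show ?thesis by simp
    qed
    also have "\<dots> = ennreal (K * D) * (ennreal (real p / u) * ennreal (2 * lam powr (1 / 2) * besselK (1 / 2) (u * lam)))"
    proof -
      have [measurable]: "mixing_kernel u (- (1 / 2)) (lam\<^sup>2) \<in> borel_measurable borel"
        unfolding mixing_kernel_def by measurable
      show ?thesis
        using half[of "- (1 / 2)"] by (simp add: nn_integral_cmult besselK_minus)
    qed
    also have "\<dots> = ennreal V"
      using K D K_half assms by (simp add: V_def ennreal_mult[symmetric])
    finally show ?thesis .
  qed
  \<comment> \<open>For \<open>s\<close> in \<open>{0..1}\<close> one has
    \<open>exp (- s) \<le> 1\<close>, \<open>exp s \<le> exp 1\<close> and
    \<open>\<nu> * s \<le> \<nu>\<close>, so the kernel is at least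
    \<open>w * exp (- (u / 2) |n|^2)\<close> on an interval of length one.\<close>
  define w where "w = exp (- (u / 2) * (lam\<^sup>2 + exp 1) - \<nu>)"
  have "noise_density ?f (K * w) (u / 2) (?f 0) V"
  proof
    fix n :: "real ^ 'p"
    have "w * exp (- (u / 2) * (norm n)\<^sup>2) = (\<integral>s. indicator {0..1::real} s * (w * exp (- (u / 2) * (norm n)\<^sup>2)) \<partial>lborel)"
      by simp
    also have "\<dots> \<le> (\<integral>s. ?W n s \<partial>lborel)"
    proof (intro integral_mono int_W)
      fix s :: real
      show "indicator {0..1} s * (w * exp (- (u / 2) * (norm n)\<^sup>2)) \<le> ?W n s"
      proof (cases "s \<in> {0..1}")
        case True
        then have s: "0 \<le> s" "s \<le> 1" by auto
        have "((norm n)\<^sup>2 + lam\<^sup>2) * exp (- s) \<le> (norm n)\<^sup>2 + lam\<^sup>2"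
          using s by (intro mult_left_le) auto
        moreover have "exp s \<le> exp 1" using s by simp
        ultimately have "((norm n)\<^sup>2 + lam\<^sup>2) * exp (- s) + exp s \<le> (norm n)\<^sup>2 + lam\<^sup>2 + exp 1"
          by linarith
        then have "u / 2 * (((norm n)\<^sup>2 + lam\<^sup>2) * exp (- s) + exp s) \<le> u / 2 * ((norm n)\<^sup>2 + lam\<^sup>2 + exp 1)"
          using assms by (intro mult_left_mono) auto
        moreover have "\<nu> * s \<le> \<nu>"
          using s by (intro mult_left_le) (auto simp: \<nu>_def)
        ultimately have "- (u / 2) * (lam\<^sup>2 + exp 1) - \<nu> + - (u / 2) * (norm n)\<^sup>2
            \<le> - (u / 2) * (((norm n)\<^sup>2 + lam\<^sup>2) * exp (- s) + exp s) - \<nu> * s"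
          by (simp add: algebra_simps)
        then show ?thesis
          using True unfolding w_def mixing_kernel_def exp_add[symmetric] by simp
      qed simp
    qed simp
    finally show "K * w * exp (- (u / 2) * (norm n)\<^sup>2) \<le> ?f n"
      unfolding f_eq using K by simp
    \<comment> \<open>The kernel decreases in the squared norm, so the density is largest at the
      origin.\<close>
    have "(\<integral>s. ?W n s \<partial>lborel) \<le> (\<integral>s. ?W 0 s \<partial>lborel)"
      using assms by (intro integral_mono int_W) (simp add: mixing_kernel_def mult_right_mono)
    then show "?f n \<le> ?f 0"
      unfolding f_eq using K by simp
    show "?f (- n) = ?f n"
      by (simp add: ndfhl_density_def)
  next
    show "0 < K * w" "0 \<le> u / 2" "0 \<le> V"
      using K D K_half assms by (auto simp: w_def V_def)
  qed (use total moment in auto)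
  then show ?thesis by blast
qed

section \<open>Capacity\<close>

lemma ndfhl_entropy_eq:
  assumes "noise_density (ndfhl_density lam u :: real ^ 'p \<Rightarrow> real) c k B V"
  shows "ndfhl_entropy lam u TYPE('p)
    = - (\<integral>x. ndfhl_density lam u (x :: real ^ 'p) * ln (ndfhl_density lam u x) \<partial>lborel)"
proof -
  interpret noise_density "ndfhl_density lam u :: real ^ 'p \<Rightarrow> real" c k B V by fact
  have "prob_space (ndfhl lam u :: (real ^ 'p) measure)"
    unfolding ndfhl_def by (rule prob_space_noise)
  then interpret information_space "ndfhl lam u :: (real ^ 'p) measure" "exp 1"
    by (simp add: information_space_def information_space_axioms_def)
  have "distributed (ndfhl lam u) lborel id (\<lambda>x :: real ^ 'p. ennreal (ndfhl_density lam u x))"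
    unfolding distributed_def ndfhl_def by (auto simp: id_def distr_id2)
  from entropy_distr[OF this] show ?thesis
    by (simp add: ndfhl_entropy_def log_def)
qed

text \<open>A bound for every positive \<open>P\<close>, not only in the limit. The gap comes from
  measuring an output of power up to \<open>P + V\<close> against a Gaussian of power
  \<open>P\<close>.\<close>

lemma capacity_bounds:
  fixes lam u P :: real
  assumes "noise_density (ndfhl_density lam u :: real ^ 'p \<Rightarrow> real) c k B V" and "0 < P"
  defines "L \<equiv> real CARD('p) / 2 * ln P + (real CARD('p) / 2 * ln (2 * pi * exp 1 / real CARD('p))
    - ndfhl_entropy lam u TYPE('p))"
  shows "L \<le> ndfhl_capacity lam u TYPE('p) P"
    and "ndfhl_capacity lam u TYPE('p) P \<le> L + real CARD('p) * V / 2 / P"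
proof -
  let ?f = "ndfhl_density lam u :: real ^ 'p \<Rightarrow> real"
  interpret N: noise_density ?f c k B V by fact
  define p where "p = CARD('p)"
  have p: "DIM(real ^ 'p) = p" "0 < p" by (auto simp: p_def)
  \<comment> \<open>This Gaussian uses the power budget \<open>P\<close> exactly. It is both the
    comparison density of the upper bound and the input of the lower bound.\<close>
  define \<sigma> where "\<sigma> = sqrt (P / p)"
  have \<sigma>: "0 < \<sigma>" "\<sigma>\<^sup>2 = P / p"
    using \<open>0 < P\<close> p by (auto simp: \<sigma>_def)
  interpret G: noise_density "gauss \<sigma> :: real ^ 'p \<Rightarrow> real" "(1 / sqrt (2 * pi * \<sigma>\<^sup>2)) ^ DIM(real ^ 'p)" "1 / (2 * \<sigma>\<^sup>2)"
    "(1 / sqrt (2 * pi * \<sigma>\<^sup>2)) ^ DIM(real ^ 'p)" "DIM(real ^ 'p) * \<sigma>\<^sup>2"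
    by (rule noise_density_gauss) fact
  define H where "H = (\<integral>x. ?f x * ln (?f x) \<partial>lborel)"
  \<comment> \<open>\<open>p / 2 * ln (2 * pi * \<sigma>^2) + p / 2\<close> is the entropy of that
    Gaussian, so \<open>L\<close> is Gaussian entropy minus noise entropy.\<close>
  have L_eq: "L = H + p / 2 * ln (2 * pi * \<sigma>\<^sup>2) + p / 2"
  proof -
    have ln: "ln (2 * pi * exp 1 / p) = ln 2 + ln pi + 1 - ln p" "ln (2 * pi * \<sigma>\<^sup>2) = ln 2 + ln pi + ln P - ln p"
      using \<open>0 < P\<close> p by (simp_all add: \<sigma> ln_mult ln_div)
    show ?thesis
      unfolding L_def ndfhl_entropy_eq[OF assms(1)] H_def[symmetric] p_def[symmetric] ln
      by (simp add: algebra_simps add_divide_distrib diff_divide_distrib)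
  qed
  let ?S = "{ndfhl_mi lam u (mu :: (real ^ 'p) measure) | mu.
       prob_space mu \<and> sets mu = sets borel \<and>
       integrable mu (\<lambda>x. norm x ^ 2) \<and> (\<integral>x. norm x ^ 2 \<partial>mu) \<le> P}"
  have upper: "m \<le> L + real CARD('p) * V / 2 / P" if "m \<in> ?S" for m
  proof -
    from that obtain mu :: "(real ^ 'p) measure" where m: "m = ndfhl_mi lam u mu" and
      mu: "prob_space mu" "sets mu = sets borel" "integrable mu (\<lambda>x. (norm x)\<^sup>2)" "(\<integral>x. (norm x)\<^sup>2 \<partial>mu) \<le> P"
      by auto
    interpret noise_channel ?f c k B V mu
      using mu by (intro noise_channel.intro noise_channel_axioms.intro assms(1)) auto
    have "m = H - (\<integral>y. out y * ln (out y) \<partial>lborel)"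
      unfolding m ndfhl_mi_def ndfhl_def information_decomposition(1) H_def ..
    also have "\<dots> \<le> H + p / 2 * ln (2 * pi * \<sigma>\<^sup>2) + 1 / (2 * \<sigma>\<^sup>2) * ((\<integral>x. (norm x)\<^sup>2 \<partial>mu) + V)"
      using output_entropy_le[OF G.measurable_f G.f_pos G.f_total ln_gauss[OF \<sigma>(1)]] by (simp add: p_def)
    also have "1 / (2 * \<sigma>\<^sup>2) * ((\<integral>x. (norm x)\<^sup>2 \<partial>mu) + V) \<le> 1 / (2 * \<sigma>\<^sup>2) * (P + V)"
      using mu(4) \<open>0 < P\<close> by (intro mult_left_mono) auto
    also have "1 / (2 * \<sigma>\<^sup>2) * (P + V) = p / 2 + p * V / 2 / P"
      using \<open>0 < P\<close> p by (simp add: \<sigma> field_simps)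
    finally show ?thesis
      by (simp add: L_eq p_def)
  qed
  have in_S: "ndfhl_mi lam u G.noise \<in> ?S"
  proof -
    have "(\<integral>x. (norm x)\<^sup>2 \<partial>G.noise) \<le> P"
      unfolding G.noise_power(2) p(1) using p(2) by (simp add: \<sigma>)
    moreover have "sets G.noise = sets borel" by simp
    ultimately show ?thesis
      using G.prob_space_noise G.noise_power(1) by blast
  qed
  have "L \<le> ndfhl_mi lam u G.noise"
  proof -
    interpret X: noise_channel ?f c k B V G.noise
      using G.prob_space_noise G.noise_power(1) by (intro noise_channel.intro noise_channel_axioms.intro assms(1)) auto
    interpret Y: noise_channel "gauss \<sigma> :: real ^ 'p \<Rightarrow> real" "(1 / sqrt (2 * pi * \<sigma>\<^sup>2)) ^ DIM(real ^ 'p)" "1 / (2 * \<sigma>\<^sup>2)"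
      "(1 / sqrt (2 * pi * \<sigma>\<^sup>2)) ^ DIM(real ^ 'p)" "DIM(real ^ 'p) * \<sigma>\<^sup>2" N.noise
      using N.prob_space_noise N.noise_power(1)
      by (intro noise_channel.intro noise_channel_axioms.intro G.noise_density_axioms) auto
    \<comment> \<open>Convolution commutes, so exchanging input and noise leaves the output density
      unchanged.\<close>
    have out: "X.out = Y.out"
    proof
      fix y
      have "X.out y = (\<integral>x. gauss \<sigma> x * ?f (y - x) \<partial>lborel)"
        unfolding X.out_def by (subst integral_density) auto
      also have "\<dots> = (\<integral>x. gauss \<sigma> (y - x) * ?f (y - (y - x)) \<partial>lborel)"
        by (rule integral_lborel_reflect[symmetric]) measurable
      also have "\<dots> = Y.out y"
        unfolding Y.out_def by (subst integral_density) (auto simp: mult.commute)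
      finally show "X.out y = Y.out y" .
    qed
    have "(\<integral>x. gauss \<sigma> (x :: real ^ 'p) * ln (gauss \<sigma> x) \<partial>lborel) = - (p / 2 * ln (2 * pi * \<sigma>\<^sup>2)) - p / 2"
      unfolding ln_gauss[OF \<sigma>(1)] G.integral_quadratic p(1) using \<open>0 < P\<close> by (simp add: \<sigma>)
    then have "L = H - (\<integral>x. gauss \<sigma> (x :: real ^ 'p) * ln (gauss \<sigma> x) \<partial>lborel)"
      by (simp add: L_eq)
    \<comment> \<open>In the exchanged channel, nonnegative information says that the output entropy
      is at least that of the Gaussian.\<close>
    also have "\<dots> \<le> H - (\<integral>y. X.out y * ln (X.out y) \<partial>lborel)"
      using Y.information_decomposition(2) by (simp add: out)
    also have "\<dots> = ndfhl_mi lam u G.noise"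
      unfolding ndfhl_mi_def ndfhl_def X.information_decomposition(1) H_def ..
    finally show ?thesis .
  qed
  \<comment> \<open>A real \<open>Sup\<close> dominates its elements only for sets bounded above, so
    the upper bound is needed here as well.\<close>
  also have "\<dots> \<le> ndfhl_capacity lam u TYPE('p) P"
    unfolding ndfhl_capacity_def using upper by (intro cSup_upper in_S bdd_aboveI)
  finally show "L \<le> ndfhl_capacity lam u TYPE('p) P" .
  show "ndfhl_capacity lam u TYPE('p) P \<le> L + real CARD('p) * V / 2 / P"
    unfolding ndfhl_capacity_def using in_S upper by (intro cSup_least) blast+
qed

theorem theorem2:
  fixes lam u :: real
  assumes "lam > 0" and "u > 0"
  shows "((\<lambda>P. ndfhl_capacity lam u TYPE('p::finite) P
             - (real CARD('p) / 2 * ln P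
                + (real CARD('p) / 2 * ln (2 * pi * exp 1 / real CARD('p))
                   - ndfhl_entropy lam u TYPE('p))))
          \<longlongrightarrow> 0) at_top"
proof -
  obtain c k B V where noise: "noise_density (ndfhl_density lam u :: real ^ 'p \<Rightarrow> real) c k B V"
    using noise_density_ndfhl[OF assms] by blast
  show ?thesis
  proof (rule tendsto_sandwich[where f="\<lambda>_. 0" and h="\<lambda>P. real CARD('p) * V / 2 / P"])
    show "((\<lambda>P. real CARD('p) * V / 2 / P) \<longlongrightarrow> 0) at_top"
      by (rule tendsto_divide_0[OF tendsto_const]) (rule filterlim_at_top_imp_at_infinity[OF filterlim_ident])
    show "\<forall>\<^sub>F P in at_top. 0 \<le> ndfhl_capacity lam u TYPE('p) P
       - (real CARD('p) / 2 * ln P + (real CARD('p) / 2 * ln (2 * pi * exp 1 / real CARD('p))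
          - ndfhl_entropy lam u TYPE('p)))"
      using eventually_gt_at_top[of 0]
      by eventually_elim (use capacity_bounds(1)[OF noise] in force)
    show "\<forall>\<^sub>F P in at_top. ndfhl_capacity lam u TYPE('p) P
       - (real CARD('p) / 2 * ln P + (real CARD('p) / 2 * ln (2 * pi * exp 1 / real CARD('p))
          - ndfhl_entropy lam u TYPE('p))) \<le> real CARD('p) * V / 2 / P"
      using eventually_gt_at_top[of 0]
      by eventually_elim (use capacity_bounds(2)[OF noise] in force)
  qed simp
qed

end
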